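(* Let $X$ be any splitting configuration of $X^\natural=Gr(2,4)[4]$, with associated matrices $L_1,T_{\mathcal O_X},T_{\mathcal S_X},T_N$ as in the context. Then the following matrix identities (coming from the fundamental group of the link $\mathfrak L^{(2)}_{4,2}$) hold: $$(T_{\mathcal S_X}T_{\mathcal O_X}L_1)^2(T_{\mathcal O_X}L_1)^2\,a=a\,(T_{\mathcal S_X}T_{\mathcal O_X}L_1)^2(T_{\mathcal O_X}L_1)^2,\qquad a\in\{L_1,T_{\mathcal O_X}\},$$ $$(T_{\mathcal S_X}T_{\mathcal O_X}L_1)^2\,T_{\mathcal S_X}=T_{\mathcal S_X}\,(T_{\mathcal S_X}T_{\mathcal O_X}L_1)^2.$$ Moreover, $$M_0\cdot L_1^4=(T_{\mathcal S_X}T_{\mathcal O_X}L_1)^2(T_{\mathcal O_X}L_1)^2=T_N,$$ where $M_0=T_N\cdot L_1^{-4}$ is the window monodromy matrix of $X$ and $N=\int_{Gr(2,4)}\big(c_2(\mathcal N)^2-c_1(\mathcal N)c_3(\mathcal N)\big)$.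
   Context: **Splitting configuration.** Let $Y=Gr(2,4)$, $\mathcal S$ its rank-2 tautological bundle, $H=c_1(\mathcal S^\vee)$. Let $\mathcal N$ be a direct sum of homogeneous bundles of the form $\mathcal O(p)\otimes\mathrm{Sym}^q\mathcal S^\vee$ ($p,q\ge0$, $(p,q)\ne(0,0)$, $\mathcal O(1)=\det\mathcal S^\vee$) with $c_1(\mathcal N)=4H$ and rank $n+1\ge2$. The splitting configuration $X\subset\mathbb P^n\times Y$ is the Calabi–Yau threefold cut out by a generic section of $\mathcal O_{\mathbb P^n}(1)\boxtimes\mathcal N$. $\mathcal S_X$ is the pullback of $\mathcal S$ to $X$. **Topological numbers.** Let $H_0=L$ be the hyperplane class of $\mathbb P^n$ and $H_1=H$. For $\alpha,\beta,\gamma\in\{0,1\}$, $c_{\alpha\beta\gamma}=\int_XH_\alpha H_\beta H_\gamma$ (so $c_{111}=8$, $c_{011}=\int_Yc_2(\mathcal N)H^2$, $c_{001}=\int_Yc_3(\mathcal N)H$, $c_{000}=\int_Yc_4(\mathcal N)$), $c_0=\frac1{24}\int_Xc_2(X)L$, $l=\frac16c_{000}+2c_0$, $b=\frac12(c_{011}-c_{001})$, $g=\int_Yc_2(\mathcal N)c_2(\mathcal S^\vee)$. **Matrices.** $6\times6$ matrices in the ordered basis $(\mathcal O_X,D_0,D_1,\widetilde C_0,\widetilde C_1,P)$, where columns are images of basis vectors: $$L_1=\begin{pmatrix}1&0&0&0&0&0\\0&1&0&0&0&0\\1&0&1&0&0&0\\c_{011}&c_{001}&c_{011}&1&0&0\\8&c_{011}&8&0&1&0\\0&b&0&0&1&1\end{pmatrix}$$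 (the twist by $\det^{-1}\mathcal S_X$). The Euler pairing $\chi(u,v)=u^t\chi v$ has matrix $$\chi=\begin{pmatrix}0&l&6&0&0&1\\-l&0&b&-1&0&0\\-6&-b&0&0&-1&0\\0&1&0&0&0&0\\0&0&1&0&0&0\\-1&0&0&0&0&0\end{pmatrix}.$$ For a class $e$, the spherical twist matrix is $T_e:v\mapsto v-\chi(e,v)\,e$. $T_{\mathcal O_X}=T_e$ with $e=(1,0,0,0,0,0)^t$, and $T_{\mathcal S_X}=T_e$ with $e=(2,0,-1,-g,-4,2)^t$, the class of $\mathcal S_X$. $T_N$ is the identity matrix plus the single entry $-N$ in row $\widetilde C_0$, column $D_0$. *)

theory Defs
  imports
    "HOL-Analysis.Analysis"
    "HOL-Computational_Algebra.Polynomial"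
    "HOL-Computational_Algebra.Formal_Power_Series"
begin

section \<open>Intersection theory on the Grassmannian\<close>

text \<open>
  Classes on \<open>Y = Gr(2,4)\<close> are represented by symmetric polynomials in the Chern roots
  \<open>x1, x2\<close> of the dual \<open>S\<^sup>\<vee>\<close> of the tautological bundle, following the Borel presentation: the
  cohomology ring of \<open>Y\<close> is the ring of symmetric polynomials in \<open>x1, x2\<close> modulo
  \<open>c\<^sub>3(Q) = h\<^sub>3\<close> and \<open>c\<^sub>4(Q) = h\<^sub>4\<close>, the complete homogeneous polynomials of degrees 3 and 4
  (\<open>Q\<close> is the quotient bundle and \<open>c(S) c(Q) = 1\<close>).  The inner polynomial variable is \<open>x1\<close>,
  the outer one is \<open>x2\<close>.
\<close>

type_synonym grclass = "real poly poly"

definition x1 :: grclass where "x1 = [:[:0, 1:]:]"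
definition x2 :: grclass where "x2 = [:0, 1:]"

text \<open>
  Integration over \<open>Y\<close> is the residue formula for a Grassmannian of 2-planes; below it is shown to
  kill the relations \<open>h\<^sub>3, h\<^sub>4\<close> and to take the value 1 on \<open>c\<^sub>2(S\<^sup>\<vee>)\<^sup>2\<close>, the class of a point.
\<close>

definition int_Y :: "grclass \<Rightarrow> real" where
  "int_Y f = coeff (coeff (f * (x1 - x2) * (x2 - x1)) 3) 3 / 2"

definition chern_total :: "'a::comm_ring_1 multiset \<Rightarrow> 'a fps" where
  "chern_total R = (\<Prod>r\<in>#R. 1 + fps_const r * fps_X)"

definition chern :: "nat \<Rightarrow> 'a::comm_ring_1 multiset \<Rightarrow> 'a" where
  "chern i R = fps_nth (chern_total R) i"

definition S_dual_roots :: "grclass multiset" where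
  "S_dual_roots = {#x1, x2#}"

definition H :: grclass where "H = chern 1 S_dual_roots"

section \<open>Splitting configurations\<close>

text \<open>
  A direct sum of bundles \<open>\<O>(p) \<otimes> Sym\<^sup>q S\<^sup>\<vee>\<close> is the multiset of its pairs \<open>(p, q)\<close>.  By the
  splitting principle such a summand has Chern roots \<open>p H + i x1 + (q - i) x2\<close>, \<open>0 \<le> i \<le> q\<close>.
\<close>

type_synonym homog_bundle = "(nat \<times> nat) multiset"

definition summand_roots :: "nat \<times> nat \<Rightarrow> grclass multiset" where
  "summand_roots = (\<lambda>(p, q). image_mset
     (\<lambda>i. of_nat p * H + of_nat i * x1 + of_nat (q - i) * x2) (mset_set {0..q}))"

definition roots :: "homog_bundle \<Rightarrow> grclass multiset" where
  "roots E = (\<Sum>s\<in>#E. summand_roots s)"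

definition bundle_rank :: "homog_bundle \<Rightarrow> nat" where
  "bundle_rank E = (\<Sum>(p, q)\<in>#E. q + 1)"

definition splitting_config :: "homog_bundle \<Rightarrow> bool" where
  "splitting_config E \<longleftrightarrow>
     (0, 0) \<notin># E \<and> chern 1 (roots E) = 4 * H \<and> bundle_rank E \<ge> 2"

text \<open>The dimension \<open>n\<close> of the projective space: the rank of the bundle is \<open>n + 1\<close>.\<close>

definition pdim :: "homog_bundle \<Rightarrow> nat" where
  "pdim E = bundle_rank E - 1"

section \<open>Intersection theory on \<open>\<P>\<^sup>n \<times> Y\<close> and on the threefold \<open>X\<close>\<close>

text \<open>
  Classes on \<open>\<P>\<^sup>n \<times> Y\<close> are polynomials in the hyperplane class \<open>Lh\<close> over the classes of \<open>Y\<close>.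
  The relation \<open>Lh\<^sup>n\<^sup>+\<^sup>1 = 0\<close> is not imposed on representatives; integration only reads the
  coefficient of \<open>Lh\<^sup>n\<close> and so kills that ideal.
\<close>

type_synonym ambclass = "grclass poly"

definition Lh :: ambclass where "Lh = [:0, 1:]"

definition pullback :: "grclass \<Rightarrow> ambclass" where "pullback f = [:f:]"

definition int_amb :: "nat \<Rightarrow> ambclass \<Rightarrow> real" where
  "int_amb n F = int_Y (coeff F n)"

text \<open>Chern roots of \<open>\<O>(1) \<boxtimes> E\<close>.\<close>

definition twisted_roots :: "homog_bundle \<Rightarrow> ambclass multiset" where
  "twisted_roots E = image_mset (\<lambda>r. Lh + pullback r) (roots E)"

text \<open>
  \<open>X\<close> is the zero locus of a generic section of \<open>\<O>(1) \<boxtimes> E\<close>, whose class in \<open>\<P>\<^sup>n \<times> Y\<close> is the top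
  Chern class.  Classes on \<open>X\<close> are given as restrictions from \<open>\<P>\<^sup>n \<times> Y\<close>.
\<close>

definition int_X :: "homog_bundle \<Rightarrow> ambclass \<Rightarrow> real" where
  "int_X E F = int_amb (pdim E) (F * chern (pdim E + 1) (twisted_roots E))"

text \<open>
  The total Chern class of a virtual bundle \<open>A - B\<close>; the inverse exists because
  \<open>chern_total B\<close> has constant term 1.
\<close>

definition chern_diff :: "'a::comm_ring_1 multiset \<Rightarrow> 'a multiset \<Rightarrow> 'a fps" where
  "chern_diff A B = chern_total A * fps_right_inverse (chern_total B) 1"

text \<open>
  The tangent bundle of \<open>X\<close> is, as a virtual bundle,
  \<open>T\<^sub>\<P> + T\<^sub>Y - \<O>(1) \<boxtimes> E\<close> restricted to \<open>X\<close>, where \<open>T\<^sub>\<P> = \<O>(1)\<^sup>n\<^sup>+\<^sup>1 - \<O>\<close> (Euler sequence) and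
  \<open>T\<^sub>Y = S\<^sup>\<vee> \<otimes> Q = (S\<^sup>\<vee>)\<^sup>4 - S\<^sup>\<vee> \<otimes> S\<close>.  The summand \<open>S\<^sup>\<vee> \<otimes> S\<close> has roots \<open>0, 0, x1 - x2, x2 - x1\<close>.
\<close>

definition tangent_pos :: "homog_bundle \<Rightarrow> ambclass multiset" where
  "tangent_pos E = replicate_mset (pdim E + 1) Lh
     + repeat_mset 4 (image_mset pullback S_dual_roots)"

definition tangent_neg :: "homog_bundle \<Rightarrow> ambclass multiset" where
  "tangent_neg E = {#0#} + image_mset pullback {#0, 0, x1 - x2, x2 - x1#} + twisted_roots E"

definition chern_X :: "nat \<Rightarrow> homog_bundle \<Rightarrow> ambclass" where
  "chern_X i E = fps_nth (chern_diff (tangent_pos E) (tangent_neg E)) i"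

section \<open>Topological numbers\<close>

definition divisor :: "nat \<Rightarrow> ambclass" where
  "divisor \<alpha> = (if \<alpha> = 0 then Lh else pullback H)"

definition triple :: "homog_bundle \<Rightarrow> nat \<Rightarrow> nat \<Rightarrow> nat \<Rightarrow> real" where
  "triple E \<alpha> \<beta> \<gamma> = int_X E (divisor \<alpha> * divisor \<beta> * divisor \<gamma>)"

abbreviation c000 :: "homog_bundle \<Rightarrow> real" where "c000 E \<equiv> triple E 0 0 0"
abbreviation c001 :: "homog_bundle \<Rightarrow> real" where "c001 E \<equiv> triple E 0 0 1"
abbreviation c011 :: "homog_bundle \<Rightarrow> real" where "c011 E \<equiv> triple E 0 1 1"

definition c0 :: "homog_bundle \<Rightarrow> real" where
  "c0 E = int_X E (chern_X 2 E * Lh) / 24"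

definition lnum :: "homog_bundle \<Rightarrow> real" where
  "lnum E = c000 E / 6 + 2 * c0 E"

definition bnum :: "homog_bundle \<Rightarrow> real" where
  "bnum E = (c011 E - c001 E) / 2"

definition gnum :: "homog_bundle \<Rightarrow> real" where
  "gnum E = int_Y (chern 2 (roots E) * chern 2 S_dual_roots)"

definition Nnum :: "homog_bundle \<Rightarrow> real" where
  "Nnum E = int_Y ((chern 2 (roots E))\<^sup>2 - chern 1 (roots E) * chern 3 (roots E))"

section \<open>Matrices\<close>

text \<open>
  The basis \<open>\<O>\<^sub>X, D\<^sub>0, D\<^sub>1, C\<^sub>0, C\<^sub>1, P\<close> is indexed by \<open>1, \<dots>, 6\<close> in the type \<open>6\<close> (in which
  \<open>6 = 0\<close>); the rows of the matrices are listed in this order.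
\<close>

type_synonym mat6 = "real^6^6"

definition L1 :: "homog_bundle \<Rightarrow> mat6" where
  "L1 E = vector [
     vector [1, 0, 0, 0, 0, 0],
     vector [0, 1, 0, 0, 0, 0],
     vector [1, 0, 1, 0, 0, 0],
     vector [c011 E, c001 E, c011 E, 1, 0, 0],
     vector [8, c011 E, 8, 0, 1, 0],
     vector [0, bnum E, 0, 0, 1, 1]]"

definition euler_matrix :: "homog_bundle \<Rightarrow> mat6" where
  "euler_matrix E = vector [
     vector [0, lnum E, 6, 0, 0, 1],
     vector [- lnum E, 0, bnum E, -1, 0, 0],
     vector [-6, - bnum E, 0, 0, -1, 0],
     vector [0, 1, 0, 0, 0, 0],
     vector [0, 0, 1, 0, 0, 0],
     vector [-1, 0, 0, 0, 0, 0]]"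

definition euler_pairing :: "homog_bundle \<Rightarrow> real^6 \<Rightarrow> real^6 \<Rightarrow> real" where
  "euler_pairing E u v = u \<bullet> (euler_matrix E *v v)"

definition spherical_twist :: "homog_bundle \<Rightarrow> real^6 \<Rightarrow> mat6" where
  "spherical_twist E e = matrix (\<lambda>v. v - euler_pairing E e v *s e)"

definition class_O :: "real^6" where
  "class_O = vector [1, 0, 0, 0, 0, 0]"

definition class_S :: "homog_bundle \<Rightarrow> real^6" where
  "class_S E = vector [2, 0, -1, - gnum E, -4, 2]"

definition T_O :: "homog_bundle \<Rightarrow> mat6" where "T_O E = spherical_twist E class_O"

definition T_S :: "homog_bundle \<Rightarrow> mat6" where "T_S E = spherical_twist E (class_S E)"

definition T_N :: "homog_bundle \<Rightarrow> mat6" where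
  "T_N E = mat 1 + (\<chi> i j. if i = 4 \<and> j = 2 then - Nnum E else 0)"

text \<open>Powers for the matrix product (the type class power on \<open>real^6^6\<close> is componentwise).\<close>

definition mpow :: "mat6 \<Rightarrow> nat \<Rightarrow> mat6" where
  "mpow A k = (((**) A) ^^ k) (mat 1)"

definition window_monodromy :: "homog_bundle \<Rightarrow> mat6" where
  "window_monodromy E = T_N E ** mpow (matrix_inv (L1 E)) 4"

section \<open>Checks\<close>

lemma int_Y_linear:
  "int_Y (f + g) = int_Y f + int_Y g" "int_Y (smult [:a:] f) = a * int_Y f"
  by (simp_all add: int_Y_def algebra_simps add_divide_distrib diff_divide_distrib)

lemma S_dual_chern:
  "H = x1 + x2" "chern 2 S_dual_roots = x1 * x2"
proof -
  have "chern_total S_dual_roots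
      = 1 + fps_const (x1 + x2) * fps_X + fps_const (x1 * x2) * fps_X\<^sup>2"
    by (simp add: chern_total_def S_dual_roots_def algebra_simps power2_eq_square
        flip: fps_const_add fps_const_mult)
  then show "H = x1 + x2" "chern 2 S_dual_roots = x1 * x2"
    by (simp_all add: H_def chern_def)
qed

lemma int_Y_point: "int_Y ((chern 2 S_dual_roots)\<^sup>2) = 1"
  by (simp add: S_dual_chern int_Y_def x1_def x2_def power2_eq_square numeral_3_eq_3 one_pCons)

lemma int_Y_H4: "int_Y (H ^ 4) = 2"
  by (simp add: S_dual_chern int_Y_def x1_def x2_def power4_eq_xxxx numeral_3_eq_3 one_pCons)

lemma coeff_mult_x1_power:
  "coeff (coeff (f * x1 ^ k) a) b = (if k \<le> b then coeff (coeff f a) (b - k) else 0)"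
proof -
  have "x1 ^ k = [:monom 1 k:]"
    by (induction k) (simp_all add: x1_def monom_Suc one_pCons)
  then show ?thesis by (simp add: mult.commute[of f] mult.commute[of _ "monom 1 k"] coeff_monom_mult)
qed

lemma coeff_mult_x2_power:
  "coeff (f * x2 ^ k) a = (if k \<le> a then coeff f (a - k) else 0)"
proof -
  have "x2 ^ k = monom 1 k"
    by (induction k) (simp_all add: x2_def monom_Suc)
  then show ?thesis by (simp add: mult.commute[of f] coeff_monom_mult)
qed

lemma int_Y_h3: "int_Y (f * (x1 ^ 3 + x1\<^sup>2 * x2 + x1 * x2\<^sup>2 + x2 ^ 3)) = 0"
proof -
  have "f * (x1 ^ 3 + x1\<^sup>2 * x2 + x1 * x2\<^sup>2 + x2 ^ 3) * (x1 - x2) * (x2 - x1)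
      = f * (x2 - x1) * x1 ^ 4 - f * (x2 - x1) * x2 ^ 4"
    by algebra
  then show ?thesis
    unfolding int_Y_def
    by (simp only: coeff_diff coeff_mult_x1_power coeff_mult_x2_power) simp
qed

lemma int_Y_h4: "int_Y (f * (x1 ^ 4 + x1 ^ 3 * x2 + x1\<^sup>2 * x2\<^sup>2 + x1 * x2 ^ 3 + x2 ^ 4)) = 0"
proof -
  have "f * (x1 ^ 4 + x1 ^ 3 * x2 + x1\<^sup>2 * x2\<^sup>2 + x1 * x2 ^ 3 + x2 ^ 4) * (x1 - x2) * (x2 - x1)
      = f * (x2 - x1) * x1 ^ 5 - f * (x2 - x1) * x2 ^ 5"
    by algebra
  then show ?thesis
    unfolding int_Y_def
    by (simp only: coeff_diff coeff_mult_x1_power coeff_mult_x2_power) simp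
qed

lemma chern_diff_mult: "chern_diff A B * chern_total B = chern_total A"
proof -
  have "fps_nth (chern_total B) 0 = 1"
    unfolding chern_total_def by (induction B) simp_all
  then have "chern_total B * fps_right_inverse (chern_total B) 1 = 1"
    by (intro fps_right_inverse) simp
  then show ?thesis
    by (simp add: chern_diff_def ac_simps)
qed

lemma chern_1: "chern 1 R = \<Sum>\<^sub># R"
proof -
  have "fps_nth (chern_total R) 0 = 1 \<and> fps_nth (chern_total R) 1 = \<Sum>\<^sub># R"
    unfolding chern_total_def by (induction R) (simp_all add: fps_mult_nth)
  then show ?thesis by (simp add: chern_def)
qed

lemma splitting_config_example: "splitting_config {#(0, 1), (0, 1), (0, 1), (0, 1)#}"
  unfolding splitting_config_def chern_1
  by (simp add: roots_def bundle_rank_def summand_roots_def S_dual_chern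
      atLeast0_atMost_Suc numeral_eq_Suc algebra_simps)

lemma size_roots: "size (roots E) = bundle_rank E"
  unfolding roots_def bundle_rank_def by (induction E) (auto simp: summand_roots_def)

end

theory Submission
  imports Defs
begin

text \<open>
  As polynomial identities in \<open>c\<^sub>0\<^sub>1\<^sub>1\<close>, \<open>c\<^sub>0\<^sub>0\<^sub>1\<close>, \<open>l\<close> and \<open>g\<close>, the matrix relations hold for arbitrary
  values of these numbers, with \<open>-N\<close> replaced by the entry
  \<open>- c\<^sub>0\<^sub>1\<^sub>1\<^sup>2 + 2 c\<^sub>0\<^sub>1\<^sub>1 g - 2 g\<^sup>2 + 4 c\<^sub>0\<^sub>0\<^sub>1\<close>.  The geometry enters only in identifying this entry:
  \<open>c\<^sub>2\<close> of the bundle is \<open>a H\<^sup>2 + b c\<^sub>2(S\<^sup>\<vee>)\<close>, so \<open>c\<^sub>0\<^sub>1\<^sub>1 = 2 a + b\<close>, \<open>g = a + b\<close> and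
  \<open>\<integral>c\<^sub>2\<^sup>2 = 2 a\<^sup>2 + 2 a b + b\<^sup>2 = c\<^sub>0\<^sub>1\<^sub>1\<^sup>2 - 2 c\<^sub>0\<^sub>1\<^sub>1 g + 2 g\<^sup>2\<close>, while \<open>c\<^sub>1 = 4 H\<close> gives
  \<open>\<integral>c\<^sub>1 c\<^sub>3 = 4 c\<^sub>0\<^sub>0\<^sub>1\<close>.
\<close>

section \<open>Chern numbers\<close>

lemma chern_0: "chern 0 R = 1"
  unfolding chern_def chern_total_def by (induction R) simp_all

lemma chern_add_mset: "chern (Suc i) (add_mset r R) = chern (Suc i) R + r * chern i R"
  by (simp add: chern_def chern_total_def distrib_right mult.assoc flip: fps_mult_fps_X_commute)

lemma chern_eq_0: "i > size R \<Longrightarrow> chern i R = 0"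
proof (induction R arbitrary: i)
  case empty
  then show ?case by (simp add: chern_def chern_total_def)
next
  case (add r R)
  then obtain k where "i = Suc k" "k > size R" by (cases i) auto
  with add.IH show ?case by (simp add: chern_add_mset)
qed

text \<open>The product is the Chern polynomial of \<open>R\<close> with its coefficients reversed:
  a further factor \<open>[:r, 1:]\<close> acts on coefficients by the recursion
  \<open>chern_add_mset\<close>.\<close>

lemma coeff_prod_linear:
  fixes R :: "'a::comm_ring_1 multiset"
  shows "j \<le> size R \<Longrightarrow> coeff (\<Prod>r\<in>#R. [:r, 1:]) j = chern (size R - j) R"
proof (induction R arbitrary: j)
  case empty
  then show ?case by (simp add: chern_def chern_total_def)
next
  case (add r R)
  define Q where "Q = (\<Prod>r\<in>#R. [:r, 1:])"
  have deg: "degree Q \<le> size R"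
    unfolding Q_def
  proof (induction R)
    case (add r R)
    then show ?case
      using degree_mult_le[of "[:r, 1:]" "\<Prod>r\<in>#R. [:r, 1:]"] by simp
  qed simp
  have step: "coeff (\<Prod>r\<in>#add_mset r R. [:r, 1:]) j = r * coeff Q j + (case j of 0 \<Rightarrow> 0 | Suc k \<Rightarrow> coeff Q k)"
    by (simp add: Q_def coeff_pCons split: nat.split)
  show ?case
  proof (cases "j \<le> size R")
    case True
    have "size (add_mset r R) - j = Suc (size R - j)" using True by simp
    \<comment> \<open>For \<open>j = 0\<close> the right side is a Chern class above the rank, so it
      vanishes and agrees with the default 0.\<close>
    moreover have "(case j of 0 \<Rightarrow> 0 | Suc k \<Rightarrow> coeff Q k) = chern (Suc (size R - j)) R"
      using True add.IH[folded Q_def]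
      by (cases j) (simp_all add: chern_eq_0 Suc_diff_Suc Suc_diff_le)
    ultimately show ?thesis
      using True add.IH[folded Q_def] unfolding step by (simp add: chern_add_mset)
  next
    case False
    then have j: "j = Suc (size R)" using add.prems by simp
    have "coeff Q j = 0" using deg j by (simp add: coeff_eq_0)
    then show ?thesis
      using j add.IH[of "size R", folded Q_def] unfolding step by (simp add: chern_0)
  qed
qed

lemma chern_size: "chern (size R) R = \<Prod>\<^sub># R"
proof -
  have "coeff (\<Prod>r\<in>#R. [:r, 1:]) 0 = \<Prod>\<^sub># R"
    by (induction R) (simp_all add: coeff_mult)
  then show ?thesis using coeff_prod_linear[of 0 R] by simp
qed

text \<open>Pushing the class of \<open>X\<close> forward to \<open>Y\<close> turns the \<open>k\<close>-th power of the hyperplane class into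
  the Chern class of degree \<open>k + 1\<close>.\<close>

lemma int_X_Lh_power:
  assumes "bundle_rank E \<ge> 1"
  shows "int_X E (Lh ^ k * pullback f) = int_Y (chern (Suc k) (roots E) * f)"
proof -
  define n where "n = pdim E"
  define Q where "Q = (\<Prod>r\<in>#roots E. [:r, 1:])"
  have n: "size (roots E) = Suc n"
    using assms by (simp add: size_roots n_def pdim_def)
  \<comment> \<open>The top Chern class is the product of the roots \<open>Lh + pullback r\<close>.
    As \<open>Lh\<close> is the outer polynomial variable, each root is
    \<open>[:r, 1:]\<close>.\<close>
  have "chern (Suc n) (twisted_roots E) = Q"
    using chern_size[of "twisted_roots E"] n
    by (simp add: twisted_roots_def Q_def Lh_def pullback_def)
  moreover have "coeff (Lh ^ k * pullback f * Q) n = chern (Suc k) (roots E) * f"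
  proof -
    have "Lh ^ k = monom 1 k"
      by (induction k) (simp_all add: Lh_def monom_Suc)
    then have "coeff (Lh ^ k * pullback f * Q) n = (if k \<le> n then f * coeff Q (n - k) else 0)"
      by (simp add: pullback_def mult.assoc coeff_monom_mult)
    also have "\<dots> = chern (Suc k) (roots E) * f"
      using coeff_prod_linear[of "n - k" "roots E"] n
      by (auto simp: Q_def chern_eq_0 Suc_diff_le mult.commute)
    finally show ?thesis .
  qed
  ultimately show ?thesis
    by (simp add: int_X_def int_amb_def flip: n_def)
qed

section \<open>Topological numbers of the threefold as integrals over the Grassmannian\<close>

lemma c011_eq:
  assumes "bundle_rank E \<ge> 1"
  shows "c011 E = int_Y (chern 2 (roots E) * H\<^sup>2)"
  using int_X_Lh_power[OF assms, of 1 "H\<^sup>2"]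
  by (simp add: triple_def divisor_def pullback_def power2_eq_square numeral_2_eq_2 mult.assoc)

lemma c001_eq:
  assumes "bundle_rank E \<ge> 1"
  shows "c001 E = int_Y (chern 3 (roots E) * H)"
  using int_X_Lh_power[OF assms, of 2 H]
  by (simp add: triple_def divisor_def power2_eq_square numeral_3_eq_3)

text \<open>The real span of \<open>H\<^sup>2\<close> and the second Chern class of the dual
  tautological bundle. Scalars of \<open>smult\<close> here are polynomials in \<open>x1\<close>;
  the form \<open>[:\<alpha>:]\<close> restricts them to real constants.\<close>

definition deg2_classes :: "grclass set" where
  "deg2_classes = {smult [:\<alpha>:] (H\<^sup>2) + smult [:\<beta>:] (x1 * x2) |\<alpha> \<beta>. True}"

lemma smult_const_add: "smult [:a + b:] p = smult [:a:] p + smult [:b:] p"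
  by (simp flip: smult_add_left)

lemma smult_numeral:
  fixes f :: grclass
  shows "smult [:numeral n:] f = numeral n * f" "smult [:- numeral n:] f = - (numeral n * f)"
    "smult [:- 1:] f = - f" "smult [:1 / 2:] (2 * f) = f"
proof -
  show num: "smult [:numeral n:] f = numeral n * f" for n f
    by (simp add: numeral_poly)
  show "smult [:- numeral n:] f = - (numeral n * f)"
    using smult_minus_left[of "[:numeral n:]" f] by (simp add: num)
  have "[:- 1:] = (- 1 :: real poly)" by (simp add: one_pCons)
  then show "smult [:- 1:] f = - f" by (metis smult_minus_left smult_1_left)
  show "smult [:1 / 2:] (2 * f) = f"
    by (simp add: numeral_poly flip: one_pCons)
qed

lemma deg2_classesI: "smult [:\<alpha>:] (H\<^sup>2) + smult [:\<beta>:] (x1 * x2) \<in> deg2_classes"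
  unfolding deg2_classes_def by blast

lemma deg2_classes_add: "f \<in> deg2_classes \<Longrightarrow> g \<in> deg2_classes \<Longrightarrow> f + g \<in> deg2_classes"
proof -
  assume "f \<in> deg2_classes" "g \<in> deg2_classes"
  then obtain a b c d where
    "f = smult [:a:] (H\<^sup>2) + smult [:b:] (x1 * x2)"
    "g = smult [:c:] (H\<^sup>2) + smult [:d:] (x1 * x2)"
    unfolding deg2_classes_def by blast
  then have "f + g = smult [:a + c:] (H\<^sup>2) + smult [:b + d:] (x1 * x2)"
    by (simp add: smult_const_add add_ac)
  then show ?thesis by (metis deg2_classesI)
qed

lemma deg2_classes_smult: "f \<in> deg2_classes \<Longrightarrow> smult [:c:] f \<in> deg2_classes"
proof -
  assume "f \<in> deg2_classes"
  then obtain a b where "f = smult [:a:] (H\<^sup>2) + smult [:b:] (x1 * x2)"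
    unfolding deg2_classes_def by blast
  then have "smult [:c:] f = smult [:c * a:] (H\<^sup>2) + smult [:c * b:] (x1 * x2)"
    by (simp add: smult_add_right mult.commute)
  then show ?thesis by (metis deg2_classesI)
qed

lemma deg2_classes_sum: "(\<And>i. i \<in> A \<Longrightarrow> f i \<in> deg2_classes) \<Longrightarrow> sum f A \<in> deg2_classes"
proof (induction A rule: infinite_finite_induct)
  case (insert i A)
  then show ?case by (simp add: deg2_classes_add)
qed (use deg2_classesI[of 0 0] in simp_all)

lemma of_nat_grclass: "(of_nat n :: grclass) = [:[:of_nat n:]:]"
  by (simp add: of_nat_poly)

text \<open>Pairing the root \<open>i\<close> with the root \<open>q - i\<close> makes each summand symmetric in \<open>x1, x2\<close>.\<close>

lemma deg2_classes_summand: "(\<Sum>r\<in>#summand_roots s. r\<^sup>2) \<in> deg2_classes"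
proof -
  obtain p q where s: "s = (p, q)" by (cases s)
  define f where "f i j = (of_nat p * H + of_nat i * x1 + of_nat j * x2)\<^sup>2" for i j
  have sym: "f i j + f j i \<in> deg2_classes" for i j
  proof -
    have "f i j + f j i = of_nat (2 * p\<^sup>2 + 2 * p * (i + j) + i\<^sup>2 + j\<^sup>2) * H\<^sup>2
        + (of_nat (4 * i * j) - of_nat (2 * (i\<^sup>2 + j\<^sup>2))) * (x1 * x2)"
      unfolding f_def S_dual_chern by (simp add: power2_eq_square algebra_simps)
    also have "\<dots> = smult [:real (2 * p\<^sup>2 + 2 * p * (i + j) + i\<^sup>2 + j\<^sup>2):] (H\<^sup>2)
        + smult [:real (4 * i * j) - real (2 * (i\<^sup>2 + j\<^sup>2)):] (x1 * x2)"
      unfolding of_nat_grclass by (simp del: of_nat_mult of_nat_add)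
    finally show ?thesis by (metis deg2_classesI)
  qed
  have "(\<Sum>r\<in>#summand_roots s. r\<^sup>2) = (\<Sum>i\<in>{0..q}. f i (q - i))"
    unfolding sum_unfold_sum_mset
    by (simp add: s summand_roots_def f_def multiset.map_comp comp_def del: of_nat_diff)
  moreover have "(\<Sum>i\<in>{0..q}. f i (q - i)) = (\<Sum>i\<in>{0..q}. f (q - i) i)"
    by (rule sum.reindex_bij_witness[of _ "\<lambda>i. q - i" "\<lambda>i. q - i"]) auto
  ultimately have "(\<Sum>r\<in>#summand_roots s. r\<^sup>2)
      = smult [:1 / 2:] (\<Sum>i\<in>{0..q}. f i (q - i) + f (q - i) i)"
    by (simp add: sum.distrib smult_numeral flip: mult_2)
  then show ?thesis
    by (simp add: deg2_classes_smult deg2_classes_sum sym)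
qed

text \<open>Newton's identity in degree 2, left undivided so that it makes sense over any
  commutative ring. It reduces the second Chern class to power sums, which are additive over direct
  summands.\<close>

lemma newton_2: "2 * chern 2 R = (\<Sum>\<^sub># R)\<^sup>2 - (\<Sum>r\<in>#R. r\<^sup>2)"
proof (induction R)
  case empty
  then show ?case by (simp add: chern_def chern_total_def)
next
  case (add r R)
  have "chern 2 (add_mset r R) = chern 2 R + r * \<Sum>\<^sub># R"
    by (metis Suc_1 chern_1 chern_add_mset)
  then show ?case
    using add.IH by (simp add: power2_eq_square algebra_simps)
qed

lemma chern_2_roots:
  assumes "chern 1 (roots E) = 4 * H"
  shows "chern 2 (roots E) \<in> deg2_classes"
proof -
  have p2: "(\<Sum>r\<in>#roots E. r\<^sup>2) \<in> deg2_classes"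
    unfolding roots_def
  proof (induction E)
    case empty
    then show ?case using deg2_classesI[of 0 0] by simp
  next
    case (add s E)
    then show ?case by (simp add: deg2_classes_add deg2_classes_summand)
  qed
  \<comment> \<open>The coefficient 16 comes from squaring the first Chern class
    \<open>4 * H\<close>.\<close>
  have "2 * chern 2 (roots E) = smult [:16:] (H\<^sup>2) + smult [:-1:] (\<Sum>r\<in>#roots E. r\<^sup>2)"
    unfolding newton_2 assms[unfolded chern_1]
    by (simp add: power_mult_distrib smult_numeral)
  moreover have "chern 2 (roots E) = smult [:1 / 2:] (2 * chern 2 (roots E))"
    by (simp add: smult_numeral)
  moreover have "smult [:16:] (H\<^sup>2) \<in> deg2_classes"
    using deg2_classesI[of 16 0] by simp
  ultimately show ?thesis
    using p2 by (metis deg2_classes_add deg2_classes_smult)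
qed

lemma int_Y_deg2_square:
  assumes "f \<in> deg2_classes"
  shows "int_Y (f\<^sup>2) = (int_Y (f * H\<^sup>2))\<^sup>2 - 2 * int_Y (f * H\<^sup>2) * int_Y (f * (x1 * x2))
    + 2 * (int_Y (f * (x1 * x2)))\<^sup>2"
proof -
  obtain a b where f: "f = smult [:a:] (H\<^sup>2) + smult [:b:] (x1 * x2)"
    using assms unfolding deg2_classes_def by blast
  have H2: "int_Y (H\<^sup>2 * H\<^sup>2) = 2" "int_Y (x1 * x2 * (x1 * x2)) = 1"
    using int_Y_H4 int_Y_point by (simp_all add: S_dual_chern power2_eq_square power4_eq_xxxx mult.assoc)
  have Hs: "int_Y (H\<^sup>2 * (x1 * x2)) = 1"
    by (simp add: S_dual_chern int_Y_def x1_def x2_def power2_eq_square numeral_3_eq_3 one_pCons)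
  have "f * H\<^sup>2 = smult [:a:] (H\<^sup>2 * H\<^sup>2) + smult [:b:] (H\<^sup>2 * (x1 * x2))"
    "f * (x1 * x2) = smult [:a:] (H\<^sup>2 * (x1 * x2)) + smult [:b:] (x1 * x2 * (x1 * x2))"
    unfolding f by (simp_all add: algebra_simps)
  then have *: "int_Y (f * H\<^sup>2) = 2 * a + b" "int_Y (f * (x1 * x2)) = a + b"
    by (simp_all add: int_Y_linear int_Y_H4 H2 Hs)
  \<comment> \<open>Expanding only one factor of the square leaves exactly the two integrals already
    expressed in \<open>a\<close> and \<open>b\<close>.\<close>
  have "f * (smult [:a:] (H\<^sup>2) + smult [:b:] (x1 * x2))
      = smult [:a:] (f * H\<^sup>2) + smult [:b:] (f * (x1 * x2))"
    by (simp only: distrib_left mult_smult_right)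
  then have "f\<^sup>2 = smult [:a:] (f * H\<^sup>2) + smult [:b:] (f * (x1 * x2))"
    unfolding f[symmetric] by (simp only: power2_eq_square)
  then have "int_Y (f\<^sup>2) = a * (2 * a + b) + b * (a + b)"
    by (simp add: int_Y_linear *)
  then show ?thesis
    unfolding * by (simp add: power2_eq_square algebra_simps)
qed

lemma Nnum_eq:
  assumes "splitting_config E"
  shows "Nnum E = (c011 E)\<^sup>2 - 2 * c011 E * gnum E + 2 * (gnum E)\<^sup>2 - 4 * c001 E"
proof -
  have E: "bundle_rank E \<ge> 1" "chern 1 (roots E) = 4 * H"
    using assms by (auto simp: splitting_config_def)
  have "(chern 2 (roots E))\<^sup>2 - chern 1 (roots E) * chern 3 (roots E)
      = (chern 2 (roots E))\<^sup>2 + smult [:-4:] (chern 3 (roots E) * H)"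
    unfolding E by (simp add: smult_numeral ac_simps)
  then have "Nnum E = int_Y ((chern 2 (roots E))\<^sup>2) - 4 * int_Y (chern 3 (roots E) * H)"
    by (simp only: Nnum_def int_Y_linear)
  then show ?thesis
    unfolding int_Y_deg2_square[OF chern_2_roots[OF E(2)]] c011_eq[OF E(1)] c001_eq[OF E(1)]
      gnum_def S_dual_chern(2) by simp
qed

section \<open>Matrix identities\<close>

lemma UNIV_6: "(UNIV :: 6 set) = {1, 2, 3, 4, 5, 6}"
proof -
  have "card {1, 2, 3, 4, 5, 6 :: 6} = CARD(6)"
    by simp
  then show ?thesis by (metis card_subset_eq finite_class.finite_UNIV subset_UNIV)
qed

lemma vector_6:
  "(vector [a, b, c, d, e, f] :: 'a::zero^6) $ 1 = a"
  "(vector [a, b, c, d, e, f] :: 'a^6) $ 2 = b"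
  "(vector [a, b, c, d, e, f] :: 'a^6) $ 3 = c"
  "(vector [a, b, c, d, e, f] :: 'a^6) $ 4 = d"
  "(vector [a, b, c, d, e, f] :: 'a^6) $ 5 = e"
  "(vector [a, b, c, d, e, f] :: 'a^6) $ 6 = f"
  unfolding vector_def by simp_all

lemma forall_6: "(\<forall>i::6. P i) \<longleftrightarrow> P 1 \<and> P 2 \<and> P 3 \<and> P 4 \<and> P 5 \<and> P 6"
proof -
  have "(\<forall>i. P i) \<longleftrightarrow> (\<forall>i\<in>UNIV. P i)" by blast
  then show ?thesis unfolding UNIV_6 by blast
qed

lemma sum_6: "sum f (UNIV :: 6 set) = f 1 + f 2 + f 3 + f 4 + f 5 + f 6"
  unfolding UNIV_6 by (simp add: add.assoc)

lemma vector_6_eq_iff: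
  "(vector [a, b, c, d, e, f] :: 'a::zero^6) = vector [a', b', c', d', e', f'] \<longleftrightarrow>
     a = a' \<and> b = b' \<and> c = c' \<and> d = d' \<and> e = e' \<and> f = f'"
  by (simp add: vec_eq_iff forall_6 vector_6)

lemma vector_6_surj: "(v :: 'a::zero^6) = vector [v $ 1, v $ 2, v $ 3, v $ 4, v $ 5, v $ 6]"
  by (simp add: vec_eq_iff forall_6 vector_6)

text \<open>Testing on a general vector lets a word in the generators be evaluated from right to
  left, without computing any matrix product.\<close>

lemma matrix_6_eqI:
  fixes A B :: mat6
  assumes "\<And>a b c d e f. A *v vector [a, b, c, d, e, f] = B *v vector [a, b, c, d, e, f]"
  shows "A = B"
  unfolding matrix_eq
proof
  fix v :: "real^6"
  show "A *v v = B *v v"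
    using assms[of "v $ 1" "v $ 2" "v $ 3" "v $ 4" "v $ 5" "v $ 6"]
    by (simp only: flip: vector_6_surj)
qed

text \<open>\<open>matrix\<close> represents a map faithfully only when the map is linear, which is
  what has to be checked.\<close>

lemma spherical_twist_mult: "spherical_twist E e *v v = v - euler_pairing E e v *s e"
proof -
  have "linear (\<lambda>v. v - euler_pairing E e v *s e)"
    by (rule linearI) (simp_all add: euler_pairing_def matrix_vector_right_distrib inner_add_right
        matrix_vector_mult_scaleR vec_eq_iff algebra_simps)
  then show ?thesis by (simp add: spherical_twist_def matrix_works)
qed

lemma mpow_2: "mpow A 2 = A ** A"
  by (simp add: mpow_def numeral_2_eq_2)

lemma mpow_mult_mpow:
  assumes "A ** B = mat 1"
  shows "mpow A k ** mpow B k = mat 1"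
proof (induction k)
  case (Suc k)
  \<comment> \<open>\<open>mpow\<close> unfolds on the left; taking a factor of \<open>B\<close> off
    the right brings the inner powers together for the induction hypothesis.\<close>
  have "mpow B (Suc k) = mpow B k ** B" for k
    unfolding mpow_def by (induction k) (simp_all add: matrix_mul_assoc)
  then have "mpow A (Suc k) ** mpow B (Suc k) = A ** (mpow A k ** mpow B k) ** B"
    by (simp add: mpow_def matrix_mul_assoc)
  with Suc assms show ?case by simp
qed (simp add: mpow_def)

section \<open>The generators acting on coordinates\<close>

lemma L1_mult: "L1 E *v vector [a, b, c, d, e, f] = vector [a, b, a + c,
    c011 E * a + c001 E * b + c011 E * c + d, 8 * a + c011 E * b + 8 * c + e, bnum E * b + e + f]"
  by (simp add: vec_eq_iff forall_6 vector_6 L1_def matrix_vector_mult_def sum_6)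

lemma euler_matrix_mult: "euler_matrix E *v vector [a, b, c, d, e, f] = vector [lnum E * b + 6 * c + f,
   - lnum E * a + bnum E * c - d, - 6 * a - bnum E * b - e, b, c, - a]"
  by (simp add: vec_eq_iff forall_6 vector_6 euler_matrix_def matrix_vector_mult_def sum_6)

lemma T_O_mult: "T_O E *v vector [a, b, c, d, e, f] =
    vector [a - (lnum E * b + 6 * c + f), b, c, d, e, f]"
  unfolding T_O_def spherical_twist_mult euler_pairing_def euler_matrix_mult class_O_def
  by (simp add: vec_eq_iff forall_6 vector_6 inner_vec_def sum_6)

text \<open>Here \<open>t\<close> is the Euler pairing of \<open>class_S E\<close> with the given
  vector.\<close>

lemma T_S_mult:
  fixes E a b c d e f
  defines "t \<equiv> 4 * a + (2 * lnum E + bnum E - gnum E) * b + 8 * c + e + 2 * f"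
  shows "T_S E *v vector [a, b, c, d, e, f] =
    vector [a - 2 * t, b, c + t, d + gnum E * t, e + 4 * t, f - 2 * t]"
  unfolding T_S_def spherical_twist_mult euler_pairing_def euler_matrix_mult class_S_def t_def
  by (simp add: vec_eq_iff forall_6 vector_6 inner_vec_def sum_6 algebra_simps)

lemma T_N_mult: "T_N E *v vector [a, b, c, d, e, f] = vector [a, b, c, d - Nnum E * b, e, f]"
  by (simp add: vec_eq_iff forall_6 vector_6 T_N_def matrix_vector_mult_add_rdistrib
      matrix_vector_mult_def[of "vec_lambda _"] sum_6)

lemmas mat6_mult = L1_mult T_O_mult T_S_mult T_N_mult

text \<open>Eliminating \<open>c001 E\<close> turns the matrix relations into polynomial identities
  without the division hidden in \<open>bnum\<close>.\<close>

lemma c001_bnum: "c001 E = c011 E - 2 * bnum E"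
  by (simp add: bnum_def field_simps)

lemma twist_word_eq_T_N:
  assumes "Nnum E = (c011 E)\<^sup>2 - 2 * c011 E * gnum E + 2 * (gnum E)\<^sup>2 - 4 * c001 E"
  shows "mpow (T_S E ** T_O E ** L1 E) 2 ** mpow (T_O E ** L1 E) 2 = T_N E"
  by (rule matrix_6_eqI)
    (simp add: mpow_2 mat6_mult vector_6_eq_iff assms c001_bnum power2_eq_square algebra_simps
      del: One_nat_def flip: matrix_vector_mul_assoc)

lemma twist_square_commute:
  "mpow (T_S E ** T_O E ** L1 E) 2 ** T_S E = T_S E ** mpow (T_S E ** T_O E ** L1 E) 2"
  by (rule matrix_6_eqI)
    (simp add: mpow_2 mat6_mult vector_6_eq_iff c001_bnum power2_eq_square algebra_simps
      del: One_nat_def flip: matrix_vector_mul_assoc)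

text \<open>Both generators preserve the second coordinate and fix the fourth basis vector, while
  \<open>T_N E\<close> only adds a multiple of the former to the coefficient of the latter.\<close>

lemma T_N_commute:
  assumes "A \<in> {L1 E, T_O E}"
  shows "T_N E ** A = A ** T_N E"
  using assms
  by (auto intro!: matrix_6_eqI
      simp: mat6_mult vector_6_eq_iff algebra_simps simp flip: matrix_vector_mul_assoc)

text \<open>\<open>L1 E\<close> is lower triangular with unit diagonal, so its kernel is
  trivial.\<close>

lemma matrix_inv_L1: "matrix_inv (L1 E) ** L1 E = mat 1"
proof -
  have "v = 0" if "L1 E *v v = 0" for v
  proof -
    have "L1 E *v vector [v $ 1, v $ 2, v $ 3, v $ 4, v $ 5, v $ 6] = vector [0, 0, 0, 0, 0, 0]"
      using that unfolding vector_6_surj[symmetric] by (simp add: vec_eq_iff forall_6 vector_6)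
    then show ?thesis
      unfolding L1_mult vector_6_eq_iff by (auto simp: vec_eq_iff forall_6)
  qed
  then have "invertible (L1 E)"
    by (metis invertible_left_inverse matrix_left_invertible_ker)
  then show ?thesis
    unfolding invertible_def matrix_inv_def by (rule someI2_ex) simp
qed

theorem proposition5p1:
  fixes E :: homog_bundle
  assumes "splitting_config E"
  shows "(\<forall>a\<in>{L1 E, T_O E}.
            mpow (T_S E ** T_O E ** L1 E) 2 ** mpow (T_O E ** L1 E) 2 ** a
          = a ** mpow (T_S E ** T_O E ** L1 E) 2 ** mpow (T_O E ** L1 E) 2)
       \<and> mpow (T_S E ** T_O E ** L1 E) 2 ** T_S E = T_S E ** mpow (T_S E ** T_O E ** L1 E) 2
       \<and> window_monodromy E ** mpow (L1 E) 4
          = mpow (T_S E ** T_O E ** L1 E) 2 ** mpow (T_O E ** L1 E) 2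
       \<and> mpow (T_S E ** T_O E ** L1 E) 2 ** mpow (T_O E ** L1 E) 2 = T_N E"
proof (intro conjI ballI)
  note word = twist_word_eq_T_N[OF Nnum_eq[OF assms]]
  show "mpow (T_S E ** T_O E ** L1 E) 2 ** mpow (T_O E ** L1 E) 2 = T_N E"
    by (rule word)
  show "mpow (T_S E ** T_O E ** L1 E) 2 ** T_S E = T_S E ** mpow (T_S E ** T_O E ** L1 E) 2"
    by (rule twist_square_commute)
  show "mpow (T_S E ** T_O E ** L1 E) 2 ** mpow (T_O E ** L1 E) 2 ** a
      = a ** mpow (T_S E ** T_O E ** L1 E) 2 ** mpow (T_O E ** L1 E) 2"
    if "a \<in> {L1 E, T_O E}" for a
    \<comment> \<open>The word equals \<open>T_N E\<close>, so centrality reduces to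
      \<open>T_N_commute\<close>.\<close>
    using T_N_commute[OF that] by (simp add: matrix_mul_assoc flip: word)
  show "window_monodromy E ** mpow (L1 E) 4
      = mpow (T_S E ** T_O E ** L1 E) 2 ** mpow (T_O E ** L1 E) 2"
    unfolding word window_monodromy_def
    by (simp add: mpow_mult_mpow[OF matrix_inv_L1] flip: matrix_mul_assoc)
qed

end
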